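(* Let $a>0$, $T>0$, $\omega>0$ and $\gamma\ge 0$ be real constants, and let $Y,Y'$ be i.i.d. nonnegative real random variables with $\mathbb{E}[e^{aY}]<\infty$. Consider the problem of choosing a measurable function $\mathcal{Z}:[0,\infty)\to[0,T]$ and setting $Z=\mathcal{Z}(Y)$ in order to solve $$\min_{\mathcal{Z}(\cdot)}\ \mathbb{E}\big[\beta(Y,Z,Y')\big]-\gamma\,\mathbb{E}[Y'+Z]\quad\text{subject to}\quad \mathbb{E}[Y+Z]\ge\omega,\quad Z\in[0,T],$$ where $$\beta(y,z,y')=\int_{y}^{y+z+y'}\big(e^{a\tau}-1\big)\,d\tau=\frac1a\Big(e^{a(y+z+y')}-e^{ay}\Big)-z-y'.$$ Let $\eta\ge 0$ be the Lagrange multiplier associated with the constraint $\mathbb{E}[Y+Z]\ge\omega$. Then the optimal solution of this problem is $Z^\star=\mathcal{Z}^\star(Y)$, where $$\mathcal{Z}^\star(y)=\left[\frac1a\ln\left(\frac{\gamma+\eta+1}{\mathbb{E}\big[e^{aY'}\big]\,e^{ay}}\right)\right]_0^T .$$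
   Context: Notation: $[x]_0^T=\min\{\max\{x,0\},T\}$ denotes the projection of the real number $x$ onto $[0,T]$. Policies $\mathcal{Z}$ that agree almost surely with respect to the law of $Y$ are identified. Setting: $Y$ is the transmission time of a status update (successive transmission times are i.i.d.; $Y'$ is the transmission time of the next update), $Z=\mathcal{Z}(Y)$ is the waiting time inserted before the next update, which is a deterministic function of the last transmission time, and $T$ is the maximum waiting time. The urgency-aware age-of-information penalty is $g(\Delta)=e^{a\Delta}-1$, so that $\beta(y,z,y')=\int_y^{y+z+y'}g(\tau)\,d\tau$ is the penalty accumulated between two consecutive receptions. The number $\gamma$ is the current (fixed) value of the Dinkelbach parameter for the fractional problem of minimizing $\mathbb{E}[\beta(Y,Z,Y')]/\mathbb{E}[Y'+Z]$ under the same constraints. The constant $\omega$ comes from the energy causality constraint and is $$\omega=-\frac{\lambda\,(2^{C/(T_cB)}-1)\,d_2^{\alpha}\,T_cB\,n_0}{\ln(1-\rho)\,M}>0,$$ with fixed positive constants $\lambda,C,T_c,B,d_2,\alpha,n_0,M$ and $\rho\in(0,1)$. Lagrange multiplier: for the constraint $\mathbb{E}[Y+Z]\ge\omega$, define the Lagrangian $$\mathcal{L}(\mathcal{Z},\eta)=\mathbb{E}\big[\beta(Y,Z,Y')-\gamma(Y'+Z)\big]+\eta\,\mathbb{E}\big[\omega-Y-Z\big],\qquad Z=\mathcal{Z}(Y).$$ That $\eta\ge0$ is the Lagrange multiplier means that the problem is feasible and the infimum of $\mathcal{L}(\mathcal{Z},\eta)$ over all measurable $\mathcal{Z}:[0,\infty)\to[0,T]$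 equals the optimal value of the constrained problem. *)

theory Defs
  imports "HOL-Probability.Probability"
begin

definition age_penalty :: "real \<Rightarrow> real \<Rightarrow> real" where
  "age_penalty a \<Delta> = exp (a * \<Delta>) - 1"

definition acc_penalty :: "real \<Rightarrow> real \<Rightarrow> real \<Rightarrow> real \<Rightarrow> real" where
  "acc_penalty a y z y' = integral {y..y + z + y'} (age_penalty a)"

lemma acc_penalty_closed_form:
  assumes "a > 0" "z \<ge> 0" "y' \<ge> 0"
  shows "acc_penalty a y z y' = (1 / a) * (exp (a * (y + z + y')) - exp (a * y)) - z - y'"
proof -
  define F where "F = (\<lambda>t. exp (a * t) / a - t)"
  have "(age_penalty a has_integral F (y + z + y') - F y) {y..y + z + y'}"
    using assms unfolding F_def age_penalty_def
    by (intro fundamental_theorem_of_calculus)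
       (auto intro!: derivative_eq_intros
             simp flip: has_real_derivative_iff_has_vector_derivative)
  then show ?thesis
    using assms unfolding acc_penalty_def F_def
    by (simp add: integral_unique field_simps)
qed

text \<open>
  Policies are represented as functions on \<open>real\<close> of which only the restriction to
  \<open>[0, \<infinity>)\<close> matters; measurability between the restricted spaces includes that
  \<open>[0, \<infinity>)\<close> is mapped into \<open>[0, T]\<close>.
\<close>

definition policies :: "real \<Rightarrow> (real \<Rightarrow> real) set" where
  "policies T = measurable (restrict_space borel {0..}) (restrict_space borel {0..T})"

definition feasible_policies ::
    "'a measure \<Rightarrow> ('a \<Rightarrow> real) \<Rightarrow> real \<Rightarrow> real \<Rightarrow> (real \<Rightarrow> real) set" where
  "feasible_policies M Y T \<omega> = {Z \<in> policies T. (\<integral>x. Y x + Z (Y x) \<partial>M) \<ge> \<omega>}"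

definition objective ::
    "'a measure \<Rightarrow> ('a \<Rightarrow> real) \<Rightarrow> ('a \<Rightarrow> real) \<Rightarrow> real \<Rightarrow> real \<Rightarrow> (real \<Rightarrow> real) \<Rightarrow> real" where
  "objective M Y Y' a \<gamma> Z =
     (\<integral>x. acc_penalty a (Y x) (Z (Y x)) (Y' x) \<partial>M) - \<gamma> * (\<integral>x. Y' x + Z (Y x) \<partial>M)"

definition lagrangian ::
    "'a measure \<Rightarrow> ('a \<Rightarrow> real) \<Rightarrow> ('a \<Rightarrow> real) \<Rightarrow> real \<Rightarrow> real \<Rightarrow> real
      \<Rightarrow> (real \<Rightarrow> real) \<Rightarrow> real \<Rightarrow> real" where
  "lagrangian M Y Y' a \<gamma> \<omega> Z \<eta> =
     (\<integral>x. acc_penalty a (Y x) (Z (Y x)) (Y' x) - \<gamma> * (Y' x + Z (Y x)) \<partial>M)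
     + \<eta> * (\<integral>x. \<omega> - Y x - Z (Y x) \<partial>M)"

text \<open>
  Both infima below are taken in \<open>real\<close>. For independent nonnegative \<open>Y\<close>, \<open>Y'\<close>
  with finite exponential moments and \<open>T \<ge> 0\<close> all integrals exist and both infima are over
  sets bounded below (the accumulated penalty is nonnegative and \<open>Z\<close> is bounded by \<open>T\<close>);
  the feasible set is required to be nonempty. So they are the genuine infima.
\<close>

definition lagrange_multiplier ::
    "'a measure \<Rightarrow> ('a \<Rightarrow> real) \<Rightarrow> ('a \<Rightarrow> real) \<Rightarrow> real \<Rightarrow> real \<Rightarrow> real \<Rightarrow> real
      \<Rightarrow> real \<Rightarrow> bool" where
  "lagrange_multiplier M Y Y' a \<gamma> T \<omega> \<eta> \<longleftrightarrow>
     \<eta> \<ge> 0 \<and> feasible_policies M Y T \<omega> \<noteq> {} \<and>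
     (INF Z \<in> policies T. lagrangian M Y Y' a \<gamma> \<omega> Z \<eta>) =
     (INF Z \<in> feasible_policies M Y T \<omega>. objective M Y Y' a \<gamma> Z)"

definition optimal_policy ::
    "'a measure \<Rightarrow> ('a \<Rightarrow> real) \<Rightarrow> ('a \<Rightarrow> real) \<Rightarrow> real \<Rightarrow> real \<Rightarrow> real \<Rightarrow> real
      \<Rightarrow> (real \<Rightarrow> real) \<Rightarrow> bool" where
  "optimal_policy M Y Y' a \<gamma> T \<omega> Z \<longleftrightarrow>
     is_arg_min (objective M Y Y' a \<gamma>) (\<lambda>W. W \<in> feasible_policies M Y T \<omega>) Z"

definition clip :: "real \<Rightarrow> real \<Rightarrow> real" where
  "clip T x = min (max x 0) T"

definition waiting_policy ::
    "'a measure \<Rightarrow> ('a \<Rightarrow> real) \<Rightarrow> real \<Rightarrow> real \<Rightarrow> real \<Rightarrow> real \<Rightarrow> real \<Rightarrow> real" where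
  "waiting_policy M Y' a \<gamma> T \<eta> y =
     clip T ((1 / a) * ln ((\<gamma> + \<eta> + 1) / ((\<integral>x. exp (a * Y' x) \<partial>M) * exp (a * y))))"

end

theory Submission
  imports Defs
begin

text \<open>
  For a policy \<open>Z\<close>, independence turns the Lagrangian into the expectation of
  \<open>B exp (a z) / a - (\<gamma> + \<eta> + 1) z\<close> at \<open>z = Z Y\<close>, up to a constant, where
  \<open>B = E[exp (a Y')] exp (a Y) \<ge> 1\<close>. This integrand is strongly convex in \<open>z \<ge> 0\<close>, and the
  clipped policy \<open>W\<close> minimizes it pointwise on \<open>[0, T]\<close>. Hence \<open>L(Z) - L(W)\<close> is at least
  \<open>a / 2\<close> times \<open>E[(Z Y - W Y)\<^sup>2]\<close>.

  The multiplier condition identifies \<open>L(W)\<close> with the constrained optimal value \<open>p\<close>, so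
  every feasible \<open>Z\<close> satisfies
  \<open>objective Z - p \<ge> (a / 2) E[(Z Y - W Y)\<^sup>2] + \<eta> (E[Y + Z Y] - \<omega>)\<close>.
  Along a minimizing sequence of feasible policies both summands tend to \<open>0\<close>. The first one
  gives \<open>E[Z Y] \<longlongrightarrow> E[W Y]\<close>, so \<open>W\<close> is feasible, and the second one then gives
  complementary slackness, so \<open>objective W = p\<close>. For an optimal \<open>Z\<close> the first summand
  vanishes, which is uniqueness.
\<close>

section \<open>Strong convexity and the scalar minimizer\<close>

lemma exp_strong_convexity:
  fixes p q :: real
  assumes "p \<ge> 0" "q \<ge> 0"
  shows "exp p - exp q - exp q * (p - q) \<ge> (p - q)\<^sup>2 / 2"
proof -
  \<comment> \<open>This is the tangent inequality at \<open>q\<close> for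
    \<open>exp x - x^2 / 2\<close>, which is convex on the nonnegative half-line because its second
    derivative \<open>exp x - 1\<close> is nonnegative there.\<close>
  have "exp p - p\<^sup>2 / 2 - (exp q - q\<^sup>2 / 2) \<ge> (exp q - q) * (p - q)"
  proof (rule f''_imp_f'[where C = "{0..}" and f'' = "\<lambda>x. exp x - 1"])
    show "convex {0::real..}" by simp
  qed (use assms in \<open>auto intro!: derivative_eq_intros\<close>)
  then show ?thesis by (simp add: power2_eq_square field_simps)
qed

lemma clip_bounds: "T \<ge> 0 \<Longrightarrow> 0 \<le> clip T x" "T \<ge> 0 \<Longrightarrow> clip T x \<le> T"
  by (auto simp: clip_def)

text \<open>Clipping the stationary point to [0, T] leaves the first-order variational inequality
  intact, and strong convexity of the exponential adds the quadratic term. Since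
  \<open>B \<ge> 1\<close>, the modulus a / 2 does not depend on \<open>B\<close>, hence later not
  on the value of \<open>Y\<close>.\<close>

lemma clipped_log_strong_minimum:
  fixes a B c T z :: real
  assumes a: "a > 0" and B: "B \<ge> 1" and c: "c > 0" and z: "0 \<le> z" "z \<le> T"
  defines "w \<equiv> clip T ((1 / a) * ln (c / B))"
  shows "(a / 2) * (z - w)\<^sup>2 \<le> (B * exp (a * z) / a - c * z) - (B * exp (a * w) / a - c * w)"
proof -
  have w: "0 \<le> w" "w \<le> T" using clip_bounds z unfolding w_def by force+
  define r where "r = (1 / a) * ln (c / B)"
  have exp_r: "B * exp (a * r) = c" using a B c by (simp add: r_def)
  have mono: "B * exp (a * s) \<le> B * exp (a * t)" if "s \<le> t" for s t
    using that a B by (intro mult_left_mono) auto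
  have "w = clip T r" by (simp add: w_def r_def)
  then consider "w = r" | "r \<le> 0" "w = 0" | "r \<ge> T" "w = T"
    using z unfolding clip_def by linarith
  \<comment> \<open>\<open>B * exp (a * w) - c\<close> is the derivative of the integrand at
    \<open>w\<close>: zero at the stationary point \<open>r\<close>, nonnegative if \<open>w\<close>
    is the left end, nonpositive if it is the right end.\<close>
  then have first_order: "(B * exp (a * w) - c) * (z - w) \<ge> 0"
  proof cases
    case 1 then show ?thesis using exp_r by simp
  next
    case 2 then show ?thesis using exp_r mono[of r w] z by (intro mult_nonneg_nonneg) auto
  next
    case 3 then show ?thesis using exp_r mono[of w r] z by (intro mult_nonpos_nonpos) auto
  qed
  \<comment> \<open>The Bregman remainder of \<open>exp\<close>; scaled by \<open>B / a\<close> it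
    is the integrand's own remainder, because the linear term contributes none.\<close>
  define D where "D = exp (a * z) - exp (a * w) - exp (a * w) * (a * z - a * w)"
  have D: "(a * (z - w))\<^sup>2 / 2 \<le> D"
    using exp_strong_convexity[of "a * z" "a * w"] a z w
    by (simp add: D_def right_diff_distrib)
  also have "\<dots> \<le> B * D"
  proof -
    have "0 \<le> D" using D by (rule order_trans[rotated]) simp
    then show ?thesis using mult_right_mono[OF B] by simp
  qed
  finally have "(a * (z - w))\<^sup>2 / 2 / a \<le> B * D / a" using a by (intro divide_right_mono) auto
  moreover have "(a * (z - w))\<^sup>2 / 2 / a = (a / 2) * (z - w)\<^sup>2"
    using a by (simp add: power2_eq_square field_simps)
  moreover have "B * D / a + (B * exp (a * w) - c) * (z - w)
      = (B * exp (a * z) / a - c * z) - (B * exp (a * w) / a - c * w)"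
    using a by (simp add: D_def field_simps)
  ultimately show ?thesis using first_order by linarith
qed

section \<open>Measurability and range of policies\<close>

text \<open>Policies are constrained only on the nonnegative half-line. Precomposing with
  \<open>max 0\<close> gives a Borel function on all of \<open>real\<close>, as composition with
  \<open>Y\<close> and the independence lemmas require.\<close>

lemma policies_extend_measurable:
  assumes "Z \<in> policies T"
  shows "(\<lambda>y. Z (max 0 y)) \<in> borel_measurable borel"
proof -
  have "(\<lambda>y::real. max 0 y) \<in> measurable borel (restrict_space borel {0..})"
    by (rule measurable_restrict_space2) auto
  from measurable_compose[OF this assms[unfolded policies_def]]
  show ?thesis by (simp add: measurable_restrict_space2_iff)
qed

lemma policies_bounds:
  assumes "Z \<in> policies T" "y \<ge> 0"
  shows "0 \<le> Z y" "Z y \<le> T"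
  using measurable_space[OF assms(1)[unfolded policies_def], of y] assms(2)
  by (auto simp: space_restrict_space)

lemma waiting_policy_in_policies:
  assumes "T > 0"
  shows "waiting_policy M Y' a \<gamma> T \<eta> \<in> policies T"
proof -
  have "waiting_policy M Y' a \<gamma> T \<eta> \<in> borel_measurable borel"
    unfolding waiting_policy_def clip_def by measurable
  then show ?thesis unfolding policies_def
    using clip_bounds[of T] assms
    by (intro measurable_restrict_space1 measurable_restrict_space2)
       (auto simp: waiting_policy_def)
qed

section \<open>The probabilistic setting and its moments\<close>

locale status_updates = prob_space M for M :: "'a measure" +
  fixes Y Y' :: "'a \<Rightarrow> real" and a T :: real
  assumes a_pos: "a > 0" and T_pos: "T > 0"
    and Y_meas [measurable]: "Y \<in> borel_measurable M"
    and Y'_meas [measurable]: "Y' \<in> borel_measurable M"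
    and Y_nonneg: "x \<in> space M \<Longrightarrow> Y x \<ge> 0" and Y'_nonneg: "x \<in> space M \<Longrightarrow> Y' x \<ge> 0"
    and indep: "indep_var borel Y borel Y'"
    and same_distr: "distr M borel Y = distr M borel Y'"
    and exp_Y_integrable: "integrable M (\<lambda>x. exp (a * Y x))"
begin

definition mgf :: real where "mgf = (\<integral>x. exp (a * Y' x) \<partial>M)"

text \<open>With \<open>c = \<gamma> + \<eta> + 1\<close> this is the \<open>z\<close>-dependent
  part of the Lagrangian integrand after averaging over \<open>Y'\<close> with \<open>Y = y\<close>
  fixed.\<close>

definition cost :: "real \<Rightarrow> real \<Rightarrow> real \<Rightarrow> real" where
  "cost c y z = mgf * exp (a * y) * exp (a * z) / a - c * z"

lemma exp_Y'_integrable: "integrable M (\<lambda>x. exp (a * Y' x))"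
proof -
  have "integrable (distr M borel Y) (\<lambda>y. exp (a * y))"
    using exp_Y_integrable by (subst integrable_distr_eq) auto
  then show ?thesis unfolding same_distr by (subst (asm) integrable_distr_eq) auto
qed

lemma integrable_of_exp_integrable:
  assumes [measurable]: "X \<in> borel_measurable M" and "\<And>x. x \<in> space M \<Longrightarrow> X x \<ge> 0"
    and "integrable M (\<lambda>x. exp (a * X x))"
  shows "integrable M X"
proof (rule Bochner_Integration.integrable_bound)
  show "integrable M (\<lambda>x. exp (a * X x) / a)" using assms by simp
  have "\<bar>X x\<bar> \<le> \<bar>exp (a * X x) / a\<bar>" if "x \<in> space M" for x
  proof -
    have "a * X x \<le> exp (a * X x)" using exp_ge_add_one_self[of "a * X x"] by linarith
    then show ?thesis using assms(2)[OF that] a_pos by (simp add: field_simps)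
  qed
  then show "AE x in M. norm (X x) \<le> norm (exp (a * X x) / a)" by auto
qed simp

lemma Y_integrable: "integrable M Y"
  by (rule integrable_of_exp_integrable[OF Y_meas Y_nonneg exp_Y_integrable])

lemma Y'_integrable: "integrable M Y'"
  by (rule integrable_of_exp_integrable[OF Y'_meas Y'_nonneg exp_Y'_integrable])

text \<open>Together with \<open>exp (a * Y x) \<ge> 1\<close> this supplies the bound
  \<open>B \<ge> 1\<close> for the scalar minimizer.\<close>

lemma mgf_ge_1: "mgf \<ge> 1"
proof -
  have "(\<integral>x. 1 \<partial>M) \<le> (\<integral>x. exp (a * Y' x) \<partial>M)"
    using exp_Y'_integrable Y'_nonneg a_pos by (intro integral_mono) auto
  then show ?thesis by (simp add: mgf_def prob_space)
qed

section \<open>Expectations under a fixed policy\<close>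

context
  fixes Z assumes Z: "Z \<in> policies T"
begin

lemma policy_measurable: "(\<lambda>x. Z (Y x)) \<in> borel_measurable M"
proof -
  have "(\<lambda>x. Z (max 0 (Y x))) \<in> borel_measurable M"
    using measurable_compose[OF Y_meas policies_extend_measurable[OF Z]] .
  then show ?thesis by (rule measurable_cong[THEN iffD1, rotated]) (simp add: Y_nonneg max_def)
qed

lemma policy_integrable: "integrable M (\<lambda>x. Z (Y x))"
  by (rule integrable_const_bound[where B = T])
     (use policies_bounds[OF Z Y_nonneg] policy_measurable in auto)

lemma exp_Y_policy_integrable: "integrable M (\<lambda>x. exp (a * Y x) * exp (a * Z (Y x)))"
proof (rule Bochner_Integration.integrable_bound)
  show "integrable M (\<lambda>x. exp (a * Y x) * exp (a * T))" using exp_Y_integrable by simp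
  show "AE x in M. norm (exp (a * Y x) * exp (a * Z (Y x))) \<le> norm (exp (a * Y x) * exp (a * T))"
    using policies_bounds[OF Z Y_nonneg] a_pos by (auto intro!: mult_left_mono)
qed (use policy_measurable in measurable)

text \<open>The waiting time is a function of \<open>Y\<close> alone, so
  \<open>exp (a * (Y + Z Y))\<close> is independent of \<open>exp (a * Y')\<close> and the
  expectation factors.\<close>

lemma exp_policy_product:
  shows "integrable M (\<lambda>x. exp (a * (Y x + Z (Y x) + Y' x)))"
    and "(\<integral>x. exp (a * (Y x + Z (Y x) + Y' x)) \<partial>M)
      = mgf * (\<integral>x. exp (a * Y x) * exp (a * Z (Y x)) \<partial>M)"
proof -
  let ?f = "\<lambda>y. exp (a * y) * exp (a * Z (max 0 y))" and ?g = "\<lambda>y::real. exp (a * y)"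
  note [measurable] = policies_extend_measurable[OF Z]
  have ind: "indep_var borel (?f \<circ> Y) borel (?g \<circ> Y')"
    by (rule indep_var_compose[OF indep]) measurable
  have eq: "x \<in> space M \<Longrightarrow> (?f \<circ> Y) x = exp (a * Y x) * exp (a * Z (Y x))" for x
    using Y_nonneg by (simp add: max_def)
  have int_f: "integrable M (?f \<circ> Y)"
    using exp_Y_policy_integrable
    by (rule Bochner_Integration.integrable_cong[THEN iffD2, rotated -1]) (use eq in auto)
  have int_g: "integrable M (?g \<circ> Y')" using exp_Y'_integrable by (simp add: comp_def)
  have prod: "x \<in> space M \<Longrightarrow>
      (?f \<circ> Y) x * (?g \<circ> Y') x = exp (a * (Y x + Z (Y x) + Y' x))" for x
    by (simp add: eq[unfolded comp_def] exp_add[symmetric] distrib_left max_def Y_nonneg)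
  show "integrable M (\<lambda>x. exp (a * (Y x + Z (Y x) + Y' x)))"
    using indep_var_integrable[OF ind int_f int_g]
    by (rule Bochner_Integration.integrable_cong[THEN iffD1, rotated -1]) (use prod in auto)
  have "(\<integral>x. exp (a * (Y x + Z (Y x) + Y' x)) \<partial>M) = (\<integral>x. (?f \<circ> Y) x * (?g \<circ> Y') x \<partial>M)"
    by (rule Bochner_Integration.integral_cong) (use prod in auto)
  also have "\<dots> = (\<integral>x. (?f \<circ> Y) x \<partial>M) * (\<integral>x. (?g \<circ> Y') x \<partial>M)"
    by (rule indep_var_lebesgue_integral[OF ind int_f int_g])
  also have "(\<integral>x. (?f \<circ> Y) x \<partial>M) = (\<integral>x. exp (a * Y x) * exp (a * Z (Y x)) \<partial>M)"
    by (rule Bochner_Integration.integral_cong) (use eq in auto)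
  finally show "(\<integral>x. exp (a * (Y x + Z (Y x) + Y' x)) \<partial>M)
      = mgf * (\<integral>x. exp (a * Y x) * exp (a * Z (Y x)) \<partial>M)"
    by (simp add: mgf_def comp_def)
qed

lemma expected_acc_penalty:
  shows "integrable M (\<lambda>x. acc_penalty a (Y x) (Z (Y x)) (Y' x))"
    and "(\<integral>x. acc_penalty a (Y x) (Z (Y x)) (Y' x) \<partial>M)
      = mgf * (\<integral>x. exp (a * Y x) * exp (a * Z (Y x)) \<partial>M) / a
        - (\<integral>x. exp (a * Y x) \<partial>M) / a - (\<integral>x. Z (Y x) \<partial>M) - (\<integral>x. Y' x \<partial>M)"
proof -
  let ?h = "\<lambda>x. exp (a * (Y x + Z (Y x) + Y' x)) / a - exp (a * Y x) / a - Z (Y x) - Y' x"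
  have eq: "x \<in> space M \<Longrightarrow> acc_penalty a (Y x) (Z (Y x)) (Y' x) = ?h x" for x
    using acc_penalty_closed_form[OF a_pos policies_bounds(1)[OF Z Y_nonneg] Y'_nonneg]
    by (simp add: diff_divide_distrib)
  note ints = exp_policy_product(1) exp_Y_integrable policy_integrable Y'_integrable
  show "integrable M (\<lambda>x. acc_penalty a (Y x) (Z (Y x)) (Y' x))"
    by (subst Bochner_Integration.integrable_cong[OF refl eq]) (use ints in auto)
  have "(\<integral>x. acc_penalty a (Y x) (Z (Y x)) (Y' x) \<partial>M) = (\<integral>x. ?h x \<partial>M)"
    by (rule Bochner_Integration.integral_cong) (use eq in auto)
  then show "(\<integral>x. acc_penalty a (Y x) (Z (Y x)) (Y' x) \<partial>M)
      = mgf * (\<integral>x. exp (a * Y x) * exp (a * Z (Y x)) \<partial>M) / a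
        - (\<integral>x. exp (a * Y x) \<partial>M) / a - (\<integral>x. Z (Y x) \<partial>M) - (\<integral>x. Y' x \<partial>M)"
    using ints by (simp add: exp_policy_product(2))
qed

lemma cost_integrable: "integrable M (\<lambda>x. cost c (Y x) (Z (Y x)))"
  using exp_Y_policy_integrable policy_integrable by (simp add: cost_def mult.assoc)

lemma objective_eq_lagrangian:
  "objective M Y Y' a \<gamma> Z
    = lagrangian M Y Y' a \<gamma> \<omega> Z \<eta> + \<eta> * ((\<integral>x. Y x + Z (Y x) \<partial>M) - \<omega>)"
  using expected_acc_penalty(1) policy_integrable Y_integrable Y'_integrable
  by (simp add: objective_def lagrangian_def prob_space algebra_simps)

text \<open>Everything free of \<open>Z\<close> is collected in the bracket, which cancels when two
  policies are compared.\<close>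

lemma lagrangian_eq_cost:
  "lagrangian M Y Y' a \<gamma> \<omega> Z \<eta> = (\<integral>x. cost (\<gamma> + \<eta> + 1) (Y x) (Z (Y x)) \<partial>M)
    + (\<eta> * (\<omega> - expectation Y) - (1 + \<gamma>) * expectation Y' - (\<integral>x. exp (a * Y x) \<partial>M) / a)"
  using expected_acc_penalty policy_integrable Y_integrable Y'_integrable exp_Y_policy_integrable
  by (simp add: lagrangian_def cost_def prob_space algebra_simps)

end

section \<open>Quadratic growth of the Lagrangian around the clipped policy\<close>

text \<open>The scalar bound with \<open>B = mgf * exp (a * Y x)\<close> and
  \<open>c = \<gamma> + \<eta> + 1\<close> is integrated over the sample space.\<close>

lemma waiting_policy_strong_minimum:
  fixes \<gamma> \<eta> :: real
  defines "W \<equiv> waiting_policy M Y' a \<gamma> T \<eta>"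
  assumes "\<gamma> \<ge> 0" "\<eta> \<ge> 0" and Z: "Z \<in> policies T"
  shows "integrable M (\<lambda>x. (Z (Y x) - W (Y x))\<^sup>2)"
    and "(a / 2) * (\<integral>x. (Z (Y x) - W (Y x))\<^sup>2 \<partial>M)
      \<le> lagrangian M Y Y' a \<gamma> \<omega> Z \<eta> - lagrangian M Y Y' a \<gamma> \<omega> W \<eta>"
proof -
  define c where "c = \<gamma> + \<eta> + 1"
  have W: "W \<in> policies T" unfolding W_def by (rule waiting_policy_in_policies[OF T_pos])
  note [measurable] = policy_measurable[OF Z] policy_measurable[OF W]
  have bound: "\<bar>Z (Y x) - W (Y x)\<bar> \<le> T" if "x \<in> space M" for x
    using policies_bounds[OF Z Y_nonneg[OF that]] policies_bounds[OF W Y_nonneg[OF that]] by auto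
  show int: "integrable M (\<lambda>x. (Z (Y x) - W (Y x))\<^sup>2)"
    by (rule integrable_const_bound[where B = "T\<^sup>2"])
       (use bound T_pos in \<open>auto simp: abs_le_square_iff[symmetric]\<close>)
  have "(a / 2) * (Z (Y x) - W (Y x))\<^sup>2 \<le> cost c (Y x) (Z (Y x)) - cost c (Y x) (W (Y x))"
    if x: "x \<in> space M" for x
  proof -
    have "1 * 1 \<le> mgf * exp (a * Y x)"
      using mgf_ge_1 Y_nonneg[OF x] a_pos by (intro mult_mono) auto
    moreover have "W (Y x) = clip T ((1 / a) * ln (c / (mgf * exp (a * Y x))))"
      by (simp add: W_def waiting_policy_def c_def mgf_def)
    ultimately show ?thesis
      using clipped_log_strong_minimum[OF a_pos, of "mgf * exp (a * Y x)" c "Z (Y x)" T]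
        policies_bounds[OF Z Y_nonneg[OF x]] assms(2,3)
      by (simp add: cost_def c_def)
  qed
  then have "(\<integral>x. (a / 2) * (Z (Y x) - W (Y x))\<^sup>2 \<partial>M)
      \<le> (\<integral>x. cost c (Y x) (Z (Y x)) - cost c (Y x) (W (Y x)) \<partial>M)"
    using int cost_integrable[OF Z] cost_integrable[OF W] by (intro integral_mono) auto
  then show "(a / 2) * (\<integral>x. (Z (Y x) - W (Y x))\<^sup>2 \<partial>M)
      \<le> lagrangian M Y Y' a \<gamma> \<omega> Z \<eta> - lagrangian M Y Y' a \<gamma> \<omega> W \<eta>"
    using cost_integrable[OF Z] cost_integrable[OF W]
    by (simp add: lagrangian_eq_cost[OF Z] lagrangian_eq_cost[OF W] c_def)
qed

section \<open>Optimality and uniqueness from the multiplier condition\<close>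

text \<open>Nonnegativity of the variance. It turns mean-square closeness of policies into closeness
  of their mean waiting times.\<close>

lemma square_expectation_le:
  fixes f :: "'a \<Rightarrow> real"
  assumes "integrable M f" "integrable M (\<lambda>x. (f x)\<^sup>2)"
  shows "(expectation f)\<^sup>2 \<le> expectation (\<lambda>x. (f x)\<^sup>2)"
  using variance_eq[OF assms] variance_positive[of f] by simp

lemma waiting_policy_optimal:
  fixes \<gamma> \<eta> \<omega> :: real
  defines "W \<equiv> waiting_policy M Y' a \<gamma> T \<eta>"
  assumes \<gamma>: "\<gamma> \<ge> 0" and mult: "lagrange_multiplier M Y Y' a \<gamma> T \<omega> \<eta>"
  shows "optimal_policy M Y Y' a \<gamma> T \<omega> W"
    and "optimal_policy M Y Y' a \<gamma> T \<omega> Z \<Longrightarrow> AE y in distr M borel Y. Z y = W y"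
proof -
  let ?L = "\<lambda>Z. lagrangian M Y Y' a \<gamma> \<omega> Z \<eta>" and ?J = "objective M Y Y' a \<gamma>"
  let ?F = "feasible_policies M Y T \<omega>"
  define slack where "slack Z = (\<integral>x. Y x + Z (Y x) \<partial>M) - \<omega>" for Z
  define dev where "dev Z = (\<integral>x. (Z (Y x) - W (Y x))\<^sup>2 \<partial>M)" for Z
  have \<eta>: "\<eta> \<ge> 0" and nonempty: "?F \<noteq> {}"
    and strong: "(INF Z \<in> policies T. ?L Z) = (INF Z \<in> ?F. ?J Z)"
    using mult by (auto simp: lagrange_multiplier_def)
  have W: "W \<in> policies T" unfolding W_def by (rule waiting_policy_in_policies[OF T_pos])
  have F_iff: "Z \<in> ?F \<longleftrightarrow> Z \<in> policies T \<and> slack Z \<ge> 0" for Z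
    by (simp add: feasible_policies_def slack_def)
  note dev_int = waiting_policy_strong_minimum(1)[OF \<gamma> \<eta>, folded W_def]
  note dev_le = waiting_policy_strong_minimum(2)[OF \<gamma> \<eta>, where \<omega> = \<omega>, folded W_def, folded dev_def]
  have dev_nonneg: "dev Z \<ge> 0" for Z by (simp add: dev_def)
  have J_eq: "?J Z = ?L Z + \<eta> * slack Z" if "Z \<in> policies T" for Z
    using objective_eq_lagrangian[OF that] by (simp add: slack_def)
  have L_min: "?L W \<le> ?L Z" if "Z \<in> policies T" for Z
  proof -
    have "0 \<le> (a / 2) * dev Z" using a_pos dev_nonneg by simp
    then show ?thesis using dev_le[OF that] by linarith
  qed
  then have "(INF Z \<in> policies T. ?L Z) = ?L W"
    using W by (intro cInf_eq_minimum) auto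
  with strong have opt_value: "(INF Z \<in> ?F. ?J Z) = ?L W" by simp
  have gap: "(a / 2) * dev Z + \<eta> * slack Z \<le> ?J Z - ?L W" if "Z \<in> ?F" for Z
    using that dev_le J_eq by (fastforce simp: F_iff)
  \<comment> \<open>Since \<open>?L W\<close> is the infimum over a nonempty feasible set, every
    larger threshold is undercut by a feasible policy; this gives the minimizing sequence
    \<open>S\<close>.\<close>
  have "\<exists>Z \<in> ?F. ?J Z < ?L W + 1 / real (Suc n)" for n
    using cInf_lessD[of "?J ` ?F" "?L W + 1 / real (Suc n)"] nonempty opt_value by auto
  then obtain S where S: "\<And>n. S n \<in> ?F" and S_lt: "\<And>n. ?J (S n) < ?L W + 1 / real (Suc n)"
    by metis
  have lim0: "(\<lambda>n. 1 / real (Suc n)) \<longlonglongrightarrow> 0"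
    using LIMSEQ_inverse_real_of_nat by (simp add: inverse_eq_divide)
  have S_pol: "S n \<in> policies T" and S_slack: "slack (S n) \<ge> 0" for n
    using S F_iff by auto
  have dev_S: "dev (S n) \<le> (2 / a) * (1 / real (Suc n))" for n
  proof -
    have "0 \<le> \<eta> * slack (S n)" using \<eta> S_slack by simp
    then have "(a / 2) * dev (S n) \<le> 1 / real (Suc n)"
      using gap[OF S[of n]] S_lt[of n] by linarith
    then have "(2 / a) * ((a / 2) * dev (S n)) \<le> (2 / a) * (1 / real (Suc n))"
      using a_pos by (intro mult_left_mono) auto
    then show ?thesis using a_pos by simp
  qed
  have slack_S: "\<eta> * slack (S n) \<le> 1 / real (Suc n)" for n
  proof -
    have "0 \<le> (a / 2) * dev (S n)" using a_pos dev_nonneg by simp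
    then show ?thesis using gap[OF S[of n]] S_lt[of n] by linarith
  qed
  \<comment> \<open>In the difference of slacks \<open>Y\<close> and \<open>\<omega>\<close> cancel,
    leaving the mean of the policy difference.\<close>
  have "(slack (S n) - slack W)\<^sup>2 \<le> dev (S n)" for n
  proof -
    note int = policy_integrable[OF S_pol, of n] policy_integrable[OF W]
    have "slack (S n) - slack W = expectation (\<lambda>x. S n (Y x) - W (Y x))"
      using int Y_integrable by (simp add: slack_def)
    then show ?thesis
      using square_expectation_le[of "\<lambda>x. S n (Y x) - W (Y x)"] int dev_int[OF S_pol]
      by (simp add: dev_def)
  qed
  with dev_S have sq_le: "(slack (S n) - slack W)\<^sup>2 \<le> (2 / a) * (1 / real (Suc n))" for n
    by (meson order_trans)
  have "(\<lambda>n. (slack (S n) - slack W)\<^sup>2) \<longlonglongrightarrow> 0"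
  proof (rule tendsto_sandwich[OF _ _ tendsto_const])
    show "(\<lambda>n. (2 / a) * (1 / real (Suc n))) \<longlonglongrightarrow> 0"
      using tendsto_mult_right_zero[OF lim0] .
  qed (use sq_le in auto)
  then have "(\<lambda>n. sqrt ((slack (S n) - slack W)\<^sup>2)) \<longlonglongrightarrow> sqrt 0" by (rule tendsto_real_sqrt)
  then have "(\<lambda>n. slack (S n) - slack W) \<longlonglongrightarrow> 0" by (simp add: tendsto_rabs_zero_iff)
  then have slack_lim: "(\<lambda>n. slack (S n)) \<longlonglongrightarrow> slack W" by (rule LIM_zero_cancel)
  have slack_W: "slack W \<ge> 0"
    by (rule LIMSEQ_le_const[OF slack_lim]) (use S_slack in auto)
  \<comment> \<open>Complementary slackness: \<open>slack_S\<close> passes to the limit, with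
    feasibility of \<open>W\<close> giving the opposite sign.\<close>
  have "\<eta> * slack W \<le> 0"
    by (rule LIMSEQ_le[OF tendsto_mult_left[OF slack_lim] lim0]) (use slack_S in auto)
  moreover have "0 \<le> \<eta> * slack W" using \<eta> slack_W by simp
  ultimately have J_W: "?J W = ?L W" using J_eq[OF W] by simp
  have W_feas: "W \<in> ?F" using W slack_W F_iff by simp
  \<comment> \<open>Weak duality: on feasible policies the term \<open>\<eta> * slack Z\<close> is
    nonnegative, so the objective dominates the Lagrangian, whose minimum is
    \<open>?L W\<close>.\<close>
  have J_ge: "?L W \<le> ?J Z" if "Z \<in> ?F" for Z
  proof -
    have "Z \<in> policies T" "0 \<le> \<eta> * slack Z" using that \<eta> by (auto simp: F_iff)
    then show ?thesis using L_min J_eq by fastforce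
  qed
  show "optimal_policy M Y Y' a \<gamma> T \<omega> W"
    unfolding optimal_policy_def is_arg_min_linorder using W_feas J_ge J_W by simp
  assume "optimal_policy M Y Y' a \<gamma> T \<omega> Z"
  then have Z: "Z \<in> ?F" and "?J Z \<le> ?J W"
    unfolding optimal_policy_def is_arg_min_linorder using W_feas by auto
  then have "(a / 2) * dev Z + \<eta> * slack Z \<le> 0" using gap[OF Z] J_W by simp
  moreover have "0 \<le> \<eta> * slack Z" using \<eta> Z F_iff by simp
  ultimately have "(a / 2) * dev Z \<le> 0" by linarith
  then have "dev Z = 0" using a_pos dev_nonneg[of Z] by (auto simp: mult_le_0_iff)
  have Z_pol: "Z \<in> policies T" using Z F_iff by simp
  have "AE x in M. (Z (Y x) - W (Y x))\<^sup>2 = 0"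
    using \<open>dev Z = 0\<close> integral_nonneg_eq_0_iff_AE[OF dev_int[OF Z_pol]] by (simp add: dev_def)
  \<comment> \<open>Inserting \<open>max 0\<close> makes the equality a Borel condition, so it can
    be moved to the law of \<open>Y\<close>. That law lives on the nonnegative half-line, where
    \<open>max 0\<close> is then removed.\<close>
  then have "AE x in M. Z (max 0 (Y x)) = W (max 0 (Y x))"
    by (rule AE_mp) (auto simp: Y_nonneg max_def)
  then have "AE y in distr M borel Y. Z (max 0 y) = W (max 0 y)"
    using policies_extend_measurable[OF Z_pol] policies_extend_measurable[OF W]
    by (subst AE_distr_iff) auto
  moreover have "AE y in distr M borel Y. 0 \<le> y"
    using Y_nonneg by (subst AE_distr_iff) auto
  ultimately show "AE y in distr M borel Y. Z y = W y"
    by eventually_elim (simp add: max_def)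
qed

end

theorem theorem1:
  fixes M :: "'a measure" and Y Y' :: "'a \<Rightarrow> real" and a T \<omega> \<gamma> \<eta> :: real
  assumes "prob_space M"
    and "a > 0" and "T > 0" and "\<omega> > 0" and "\<gamma> \<ge> 0"
    and "Y \<in> borel_measurable M" and "Y' \<in> borel_measurable M"
    and "\<And>x. x \<in> space M \<Longrightarrow> Y x \<ge> 0" and "\<And>x. x \<in> space M \<Longrightarrow> Y' x \<ge> 0"
    and "prob_space.indep_var M borel Y borel Y'"
    and "distr M borel Y = distr M borel Y'"
    and "integrable M (\<lambda>x. exp (a * Y x))"
    and "lagrange_multiplier M Y Y' a \<gamma> T \<omega> \<eta>"
  shows "optimal_policy M Y Y' a \<gamma> T \<omega> (waiting_policy M Y' a \<gamma> T \<eta>)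
    \<and> (\<forall>Z. optimal_policy M Y Y' a \<gamma> T \<omega> Z \<longrightarrow>
           (AE y in distr M borel Y. Z y = waiting_policy M Y' a \<gamma> T \<eta> y))"
proof -
  interpret status_updates M Y Y' a T
    using assms unfolding status_updates_def status_updates_axioms_def by blast
  show ?thesis using waiting_policy_optimal[OF assms(5) assms(13)] by blast
qed

end
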